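(* Let $d,n\in\mathbb{N}$, $\alpha\in(0,\infty)$ and $h\in(0,\infty)$. For $j=(j_1,\ldots,j_d)\in\mathbb{Z}^d$ set $x_j:=(j_1h,\ldots,j_dh)$. Given data $(X_1,Y_1),\ldots,(X_{2n},Y_{2n})$ with values in $\mathbb{R}^d\times\{0,1\}$, define for each $i=1,\ldots,2n$ the binary array $$B_i:=\bigl(\mathbf{1}_{\{\|X_i-x_j\|_\infty<h\}}\bigr)_{j\in\mathbb{Z}^d},$$ and let $\epsilon_i=(\epsilon_{ij})_{j\in\mathbb{Z}^d}$, $i=1,\ldots,2n$, be random arrays, independent of each other and of the data, whose entries are independent and identically distributed $\mathrm{Laplace}(\alpha/2^{d+1})$ random variables. Set $$Z_i:=B_i+\epsilon_i\ \text{ for } i\in\{1,\ldots,n\},\qquad Z_i:=Y_iB_i+\epsilon_i\ \text{ for } i\in\{n+1,\ldots,2n\}.$$ Let $Q$ be the privacy mechanism that takes $(X_1,Y_1),\ldots,(X_{2n},Y_{2n})$ as input and outputs $Z_1,\ldots,Z_{2n}$. Then $Q$ is $\alpha$-locally differentially private, i.e. $Q\in\mathcal{Q}_\alpha$.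
   Context: Laplace convention: $\mathrm{Laplace}(b)$ denotes the distribution on $\mathbb{R}$ with density $z\mapsto \frac{b}{2}e^{-b|z|}$ (so $b$ is a rate parameter). $\|\cdot\|_\infty$ is the sup-norm on $\mathbb{R}^d$. Local differential privacy. Let $N$ be the sample size (here $N=2n$) and let $(\mathcal{Z},\mathcal{B})$ be the measurable space in which each $Z_i$ takes values (here $\mathcal{Z}=\mathbb{R}^{\mathbb{Z}^d}$ with its product $\sigma$-algebra). A (sequentially interactive, local) privacy mechanism $Q$ is a Markov kernel from $(\mathbb{R}^d\times\{0,1\})^N$ to $(\mathcal{Z}^N,\mathcal{B}^N)$ specified by conditional distributions $Q_i$, $i=1,\ldots,N$, with $Z_i\mid\{(X_i,Y_i)=u_i,Z_1=z_1,\ldots,Z_{i-1}=z_{i-1}\}\sim Q_i(\cdot\mid u_i,z_1,\ldots,z_{i-1})$, where $Z_i$ is conditionally independent of $(X_j,Y_j)$, $j\neq i$, given $(X_i,Y_i,Z_1,\ldots,Z_{i-1})$. It is $\alpha$-locally differentially private ($\alpha$-LDP) if for every $i=1,\ldots,N$, $$\sup_{A\in\mathcal{B}}\ \sup_{z_1,\ldots,z_{i-1}}\ \sup_{u_i,u_i'}\frac{Q_i(A\mid u_i,z_1,\ldots,z_{i-1})}{Q_i(A\mid u_i',z_1,\ldots,z_{i-1})}\le e^\alpha,$$ that is, $Q_i(A\mid u_i,z_1,\ldots,z_{i-1})\le e^\alpha Q_i(A\mid u_i',z_1,\ldots,z_{i-1})$ for all $A,u_i,u_i',z_1,\ldots,z_{i-1}$.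 $\mathcal{Q}_\alpha$ denotes the set of $\alpha$-LDP mechanisms. A mechanism is non-interactive if $Q_i$ does not depend on $z_1,\ldots,z_{i-1}$. *)

theory Defs
  imports "HOL-Probability.Probability"
begin

text \<open>
  In the definitions of privacy, \<open>U\<close> is the measurable space of a single observation and \<open>S\<close> the measurable space of
  a single privatised output; only their spaces and sigma-algebras matter. Samples of size \<open>N\<close> are
  points of the product over the index set \<open>{1..N}\<close>.
\<close>

text \<open>
  A family \<open>K\<close> of conditional distributions: \<open>K i (u, z)\<close> is the law of the \<open>i\<close>-th output given that
  the \<open>i\<close>-th observation is \<open>u\<close> and the outputs \<open>1, \<dots>, i - 1\<close> are \<open>z\<close>.  That \<open>K i\<close> sees
  only the \<open>i\<close>-th observation is the required conditional independence of the \<open>i\<close>-th output of the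
  remaining observations.
\<close>

definition conditional_kernels ::
    "nat \<Rightarrow> 'u measure \<Rightarrow> 'z measure \<Rightarrow> (nat \<Rightarrow> 'u \<times> (nat \<Rightarrow> 'z) \<Rightarrow> 'z measure) \<Rightarrow> bool" where
  "conditional_kernels N U S K \<longleftrightarrow>
     (\<forall>i\<in>{1..N}. K i \<in> measurable (U \<Otimes>\<^sub>M PiM {1..<i} (\<lambda>_. S)) (prob_algebra S))"

text \<open>The joint law of the first \<open>m\<close> outputs, when the observations are \<open>u 1, u 2, \<dots>\<close>.\<close>

primrec joint_output ::
    "'z measure \<Rightarrow> (nat \<Rightarrow> 'u \<times> (nat \<Rightarrow> 'z) \<Rightarrow> 'z measure) \<Rightarrow> (nat \<Rightarrow> 'u) \<Rightarrow> nat \<Rightarrow>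
      (nat \<Rightarrow> 'z) measure" where
  "joint_output S K u 0 = return (PiM {1..0} (\<lambda>_. S)) (\<lambda>_. undefined)"
| "joint_output S K u (Suc m) =
     joint_output S K u m \<bind>
       (\<lambda>z. distr (K (Suc m) (u (Suc m), z)) (PiM {1..Suc m} (\<lambda>_. S)) (\<lambda>w. z(Suc m := w)))"

definition specified_by ::
    "nat \<Rightarrow> 'u measure \<Rightarrow> 'z measure \<Rightarrow> ((nat \<Rightarrow> 'u) \<Rightarrow> (nat \<Rightarrow> 'z) measure) \<Rightarrow>
      (nat \<Rightarrow> 'u \<times> (nat \<Rightarrow> 'z) \<Rightarrow> 'z measure) \<Rightarrow> bool" where
  "specified_by N U S Q K \<longleftrightarrow>
     conditional_kernels N U S K \<and>
     (\<forall>u\<in>space (PiM {1..N} (\<lambda>_. U)). Q u = joint_output S K u N)"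

definition ldp_kernels ::
    "nat \<Rightarrow> 'u measure \<Rightarrow> 'z measure \<Rightarrow> real \<Rightarrow> (nat \<Rightarrow> 'u \<times> (nat \<Rightarrow> 'z) \<Rightarrow> 'z measure) \<Rightarrow> bool" where
  "ldp_kernels N U S \<alpha> K \<longleftrightarrow>
     (\<forall>i\<in>{1..N}. \<forall>A\<in>sets S. \<forall>z\<in>space (PiM {1..<i} (\<lambda>_. S)). \<forall>u\<in>space U. \<forall>u'\<in>space U.
        measure (K i (u, z)) A \<le> exp \<alpha> * measure (K i (u', z)) A)"

definition ldp_mechanisms ::
    "nat \<Rightarrow> 'u measure \<Rightarrow> 'z measure \<Rightarrow> real \<Rightarrow> ((nat \<Rightarrow> 'u) \<Rightarrow> (nat \<Rightarrow> 'z) measure) set" where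
  "ldp_mechanisms N U S \<alpha> =
     {Q. Q \<in> measurable (PiM {1..N} (\<lambda>_. U)) (prob_algebra (PiM {1..N} (\<lambda>_. S))) \<and>
         (\<exists>K. specified_by N U S Q K \<and> ldp_kernels N U S \<alpha> K)}"

text \<open>The parameter \<open>b\<close> is a rate, not a scale.\<close>

definition laplace_density :: "real \<Rightarrow> real \<Rightarrow> real" where
  "laplace_density b z = b / 2 * exp (- b * \<bar>z\<bar>)"

abbreviation observation_space :: "((real ^ 'd) \<times> real) measure" where
  "observation_space \<equiv> borel \<Otimes>\<^sub>M count_space {0, 1}"

abbreviation array_space :: "((int ^ 'd) \<Rightarrow> real) measure" where
  "array_space \<equiv> PiM UNIV (\<lambda>_. borel)"

definition grid_point :: "real \<Rightarrow> int ^ 'd \<Rightarrow> real ^ 'd" where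
  "grid_point h j = (\<chi> k. of_int (j $ k) * h)"

definition bin_array :: "real \<Rightarrow> real ^ 'd \<Rightarrow> int ^ 'd \<Rightarrow> real" where
  "bin_array h x = (\<lambda>j. if infnorm (x - grid_point h j) < h then 1 else 0)"

text \<open>
  The first \<open>n\<close> outputs release the indicators themselves, the later ones the indicators multiplied by
  the binary label \<open>y\<close>; here \<open>e\<close> is the noise array.
\<close>

definition privatise ::
    "nat \<Rightarrow> real \<Rightarrow> nat \<Rightarrow> (real ^ 'd) \<times> real \<Rightarrow> (int ^ 'd \<Rightarrow> real) \<Rightarrow> int ^ 'd \<Rightarrow> real" where
  "privatise n h i = (\<lambda>(x, y) e j.
     (if i \<le> n then bin_array h x j else y * bin_array h x j) + e j)"

end

theory Submission
  imports Defs
begin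

text \<open>
  Two observations change only few cells of the grid.  The indicator of the cell centred at
  \<open>j h\<close> can be nonzero at \<open>x\<close> only if every \<open>j k\<close> is one of the two integers next to \<open>x k / h\<close>, so
  a bin array has at most \<open>2 ^ d\<close> nonzero entries (\<open>bin_array_support\<close>).  Two inputs therefore give
  arrays that differ in at most \<open>2 ^ (d + 1)\<close> entries, each time by at most 1, and the noise rate
  \<open>\<alpha> / 2 ^ (d + 1)\<close> makes every differing entry contribute a factor of at most
  \<open>exp (\<alpha> / 2 ^ (d + 1))\<close> to the likelihood ratio (\<open>emeasure_shift_laplace_le\<close>).

  There is no joint density to multiply, because the array has infinitely many entries.  The ratio
  bound is instead transported from the entries to the infinite product one coordinate at a time:
  by Fubini, replacing one factor of a product measure by another one changes the measure of every set
  by at most the ratio of these two factors (\<open>emeasure_PiM_le_power_card\<close>).  This gives the factor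
  \<open>exp \<alpha>\<close> for a single output (\<open>privatise_emeasure_le\<close>).

  The rest identifies the laws.  With independent noise arrays the law of all outputs for fixed
  observations is the product of the laws of the single outputs, which is what sequential composition
  of kernels that ignore the past produces (\<open>joint_output_noninteractive\<close>).  As the noise is
  independent of the data, substituting the random data for the fixed observations gives a version of
  the conditional law (\<open>distr_graph_eq_bind\<close>).
\<close>

section \<open>Ratio bounds for product measures\<close>

text \<open>
  Write the product as the \<open>k\<close>-th factor times the rest.  The rest is the same for both
  families, and on each section of the set the bound for the \<open>k\<close>-th factors applies.
\<close>

lemma emeasure_PiM_insert_mono:
  fixes D D' :: "'i \<Rightarrow> 'a measure"
  assumes prob: "\<And>i. i \<in> insert k J \<Longrightarrow> prob_space (D i)" "prob_space (D' k)"
    and sets: "sets (D k) = sets (D' k)"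
    and eq: "\<And>i. i \<in> J \<Longrightarrow> D i = D' i"
    and le: "\<And>A. A \<in> sets (D k) \<Longrightarrow> emeasure (D k) A \<le> c * emeasure (D' k) A"
    and A: "A \<in> sets (PiM (insert k J) D)"
  shows "emeasure (PiM (insert k J) D) A \<le> c * emeasure (PiM (insert k J) D') A"
proof -
  let ?upd = "\<lambda>(x, f). f(k := x)"
  have sets_D': "sets (D i) = sets (D' i)" if "i \<in> insert k J" for i
    using that sets eq by auto
  have prob_D': "prob_space (D' i)" if "i \<in> insert k J" for i
    using that prob eq by (metis insert_iff)
  have rest: "PiM J D = PiM J D'"
    using eq by (intro PiM_cong) auto
  interpret k: prob_space "D k" using prob by auto
  interpret k': prob_space "D' k" using prob by auto
  interpret R: prob_space "PiM J D'"
    using prob_D' by (intro prob_space_PiM) auto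
  interpret P: pair_sigma_finite "D k" "PiM J D'" ..
  interpret P': pair_sigma_finite "D' k" "PiM J D'" ..
  have upd: "?upd \<in> measurable (D k \<Otimes>\<^sub>M PiM J D') (PiM (insert k J) D)"
    unfolding rest[symmetric] by measurable
  have sets_pair: "sets (D k \<Otimes>\<^sub>M PiM J D') = sets (D' k \<Otimes>\<^sub>M PiM J D')"
    by (intro sets_pair_measure_cong sets refl)
  have sets_PiM: "sets (PiM (insert k J) D) = sets (PiM (insert k J) D')"
    by (intro sets_PiM_cong sets_D' refl)
  have upd': "?upd \<in> measurable (D' k \<Otimes>\<^sub>M PiM J D') (PiM (insert k J) D')"
    by measurable
  define B where "B = ?upd -` A \<inter> space (D k \<Otimes>\<^sub>M PiM J D')"
  have B: "B \<in> sets (D k \<Otimes>\<^sub>M PiM J D')" "B \<in> sets (D' k \<Otimes>\<^sub>M PiM J D')"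
    using measurable_sets[OF upd A] sets_pair by (auto simp: B_def)
  have "emeasure (PiM (insert k J) D) A =
      emeasure (distr (D k \<Otimes>\<^sub>M PiM J D) (PiM (insert k J) D) ?upd) A"
    using prob by (subst distr_pair_PiM_eq_PiM) auto
  also have "\<dots> = emeasure (D k \<Otimes>\<^sub>M PiM J D') B"
    using upd A by (simp add: rest emeasure_distr B_def)
  also have "\<dots> = (\<integral>\<^sup>+f. emeasure (D k) ((\<lambda>x. (x, f)) -` B) \<partial>PiM J D')"
    by (rule P.emeasure_pair_measure_alt2[OF B(1)])
  also have "\<dots> \<le> (\<integral>\<^sup>+f. c * emeasure (D' k) ((\<lambda>x. (x, f)) -` B) \<partial>PiM J D')"
    using sets_Pair2[OF B(1)] by (intro nn_integral_mono le)
  also have "\<dots> = c * (\<integral>\<^sup>+f. emeasure (D' k) ((\<lambda>x. (x, f)) -` B) \<partial>PiM J D')"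
    using P'.measurable_emeasure_Pair2[OF B(2)] by (intro nn_integral_cmult)
  also have "(\<integral>\<^sup>+f. emeasure (D' k) ((\<lambda>x. (x, f)) -` B) \<partial>PiM J D') =
      emeasure (D' k \<Otimes>\<^sub>M PiM J D') B"
    by (rule P'.emeasure_pair_measure_alt2[OF B(2), symmetric])
  also have "\<dots> = emeasure (distr (D' k \<Otimes>\<^sub>M PiM J D') (PiM (insert k J) D') ?upd) A"
    using upd' A sets_PiM sets_eq_imp_space_eq[OF sets_pair]
    by (simp add: emeasure_distr B_def)
  also have "\<dots> = emeasure (PiM (insert k J) D') A"
    using prob_D' by (subst distr_pair_PiM_eq_PiM) auto
  finally show ?thesis .
qed

text \<open>
  The factors in \<open>F\<close> are exchanged one after the other, so each of them costs one factor \<open>c\<close>.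
  The index set \<open>I\<close> may be infinite.
\<close>

lemma emeasure_PiM_le_power_card:
  fixes D D' :: "'i \<Rightarrow> 'a measure"
  assumes "finite F" "F \<subseteq> I"
    and "\<And>i. i \<in> I \<Longrightarrow> prob_space (D i)" "\<And>i. i \<in> I \<Longrightarrow> prob_space (D' i)"
    and "\<And>i. i \<in> I \<Longrightarrow> sets (D i) = sets (D' i)"
    and "\<And>i. i \<in> I - F \<Longrightarrow> D i = D' i"
    and "\<And>i A. i \<in> F \<Longrightarrow> A \<in> sets (D i) \<Longrightarrow> emeasure (D i) A \<le> c * emeasure (D' i) A"
    and "A \<in> sets (PiM I D)"
  shows "emeasure (PiM I D) A \<le> c ^ card F * emeasure (PiM I D') A"
  using assms
proof (induction F arbitrary: D rule: finite_induct)
  case empty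
  then have "PiM I D = PiM I D'" by (intro PiM_cong) auto
  then show ?case by simp
next
  case (insert k F D)
  \<comment> \<open>\<open>E\<close> is the intermediate family: \<open>D\<close> and \<open>E\<close> differ only at \<open>k\<close>, \<open>E\<close> and \<open>D'\<close> only on \<open>F\<close>.\<close>
  define E where "E = D(k := D' k)"
  have I: "I = insert k (I - {k})" using insert.prems by auto
  have sets_E: "sets (PiM I D) = sets (PiM I E)"
    using insert.prems by (intro sets_PiM_cong) (auto simp: E_def)
  have "emeasure (PiM (insert k (I - {k})) D) A \<le> c * emeasure (PiM (insert k (I - {k})) E) A"
    using insert.prems I
    by (intro emeasure_PiM_insert_mono) (auto simp: E_def)
  then have "emeasure (PiM I D) A \<le> c * emeasure (PiM I E) A"
    using I by simp
  also have "emeasure (PiM I E) A \<le> c ^ card F * emeasure (PiM I D') A"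
  proof (rule insert.IH)
    show "A \<in> sets (PiM I E)" using insert.prems sets_E by simp
  qed (use insert.prems insert.hyps in \<open>auto simp: E_def\<close>)
  finally show ?case
    using insert.hyps by (simp add: mult.assoc mult_left_mono)
qed

section \<open>Shifted Laplace noise\<close>

lemma laplace_density_shift_le:
  assumes "b \<ge> 0"
  shows "laplace_density b (x - s) \<le> exp (b * \<bar>s - t\<bar>) * laplace_density b (x - t)"
proof -
  have "b * \<bar>x - t\<bar> \<le> b * (\<bar>s - t\<bar> + \<bar>x - s\<bar>)"
    using assms by (intro mult_left_mono) auto
  then have "exp (- b * \<bar>x - s\<bar>) \<le> exp (b * \<bar>s - t\<bar>) * exp (- b * \<bar>x - t\<bar>)"
    by (simp add: exp_add[symmetric] algebra_simps)
  then show ?thesis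
    using assms mult_left_mono[of "exp (- b * \<bar>x - s\<bar>)"
      "exp (b * \<bar>s - t\<bar>) * exp (- b * \<bar>x - t\<bar>)" "b / 2"]
    by (simp add: laplace_density_def mult_ac)
qed

lemma (in prob_space) emeasure_shift_laplace_le:
  assumes X: "distributed M lborel X (laplace_density b)" and b: "b \<ge> 0" and A: "A \<in> sets borel"
  shows "emeasure (distr M borel (\<lambda>\<omega>. s + X \<omega>)) A \<le>
    exp (b * \<bar>s - t\<bar>) * emeasure (distr M borel (\<lambda>\<omega>. t + X \<omega>)) A"
proof -
  have shift: "emeasure (distr M borel (\<lambda>\<omega>. r + X \<omega>)) A =
      (\<integral>\<^sup>+x. ennreal (laplace_density b (x - r)) * indicator A x \<partial>lborel)" for r
  proof -
    \<comment> \<open>The trivial scaling by 1 gives the statement the shape of the affine transformation rule.\<close>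
    have d: "distributed M lborel (\<lambda>\<omega>. r + 1 * X \<omega>)
        (\<lambda>x. ennreal (laplace_density b ((x - r) / 1)) / ennreal \<bar>1\<bar>)"
      using distributed_affine[OF X, of 1 r] by simp
    have "distr M borel (\<lambda>\<omega>. r + X \<omega>) = distr M lborel (\<lambda>\<omega>. r + X \<omega>)"
      by (intro distr_cong) auto
    also have "\<dots> = density lborel (\<lambda>x. ennreal (laplace_density b (x - r)))"
      using distributed_distr_eq_density[OF d] by (simp add: ennreal_divide_self divide_ennreal_def)
    finally show ?thesis
      using A by (simp add: emeasure_density laplace_density_def)
  qed
  have "(\<integral>\<^sup>+x. ennreal (laplace_density b (x - s)) * indicator A x \<partial>lborel) \<le>
      (\<integral>\<^sup>+x. exp (b * \<bar>s - t\<bar>) * (ennreal (laplace_density b (x - t)) * indicator A x) \<partial>lborel)"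
    using laplace_density_shift_le[OF b, of _ s t]
    by (intro nn_integral_mono)
       (auto simp: ennreal_mult'[symmetric] ennreal_leI mult.assoc[symmetric] split: split_indicator)
  also have "\<dots> = exp (b * \<bar>s - t\<bar>) *
      (\<integral>\<^sup>+x. ennreal (laplace_density b (x - t)) * indicator A x \<partial>lborel)"
    using A by (intro nn_integral_cmult) (simp add: laplace_density_def)
  finally show ?thesis by (simp only: shift)
qed

section \<open>Cells met by a point\<close>

text \<open>
  The open interval of length 2 around \<open>t = x k / h\<close> contains at most the two integers
  \<open>\<lfloor>t\<rfloor>\<close> and \<open>\<lfloor>t\<rfloor> + 1\<close>, which leaves two choices for each of the \<open>d\<close> coordinates of \<open>j\<close>.
\<close>

lemma bin_array_support:
  fixes x :: "real ^ 'd"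
  assumes "h > 0"
  shows "finite {j. bin_array h x j \<noteq> 0}" "card {j. bin_array h x j \<noteq> 0} \<le> 2 ^ CARD('d)"
proof -
  let ?B = "\<lambda>k. {\<lfloor>x $ k / h\<rfloor>, \<lfloor>x $ k / h\<rfloor> + 1}"
  let ?C = "vec_lambda ` (\<Pi>\<^sub>E k\<in>UNIV. ?B k)"
  have "j $ k \<in> ?B k" if "bin_array h x j \<noteq> 0" for j :: "int ^ 'd" and k
  proof -
    have "\<bar>(x - grid_point h j) $ k\<bar> < h"
      using that component_le_infnorm_cart[of "x - grid_point h j" k]
      by (auto simp: bin_array_def split: if_splits)
    then have "\<bar>x $ k - of_int (j $ k) * h\<bar> < h"
      by (simp add: grid_point_def)
    then have "x $ k / h < of_int (j $ k) + 1" "of_int (j $ k) - 1 < x $ k / h"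
      using assms by (auto simp: field_simps abs_less_iff)
    then have "\<lfloor>x $ k / h\<rfloor> \<le> j $ k" "j $ k \<le> \<lfloor>x $ k / h\<rfloor> + 1"
      by linarith+
    then show ?thesis by auto
  qed
  then have sub: "{j. bin_array h x j \<noteq> 0} \<subseteq> ?C"
    by (auto intro!: image_eqI[of _ _ "vec_nth _"])
  have fin: "finite (\<Pi>\<^sub>E k\<in>UNIV. ?B k)"
    by (intro finite_PiE) auto
  then show "finite {j. bin_array h x j \<noteq> 0}"
    using sub by (meson finite_imageI finite_subset)
  have "card {j. bin_array h x j \<noteq> 0} \<le> card ?C"
    using sub fin by (intro card_mono) auto
  also have "\<dots> \<le> card (\<Pi>\<^sub>E k\<in>UNIV. ?B k)"
    by (intro card_image_le fin)
  also have "\<dots> = 2 ^ CARD('d)"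
    by (simp add: card_PiE numeral_2_eq_2)
  finally show "card {j. bin_array h x j \<noteq> 0} \<le> 2 ^ CARD('d)" .
qed

section \<open>Independence and composition of kernels\<close>

lemma (in pair_prob_space) distr_pair_eq_bind:
  assumes H: "H \<in> measurable (M1 \<Otimes>\<^sub>M M2) N"
  shows "distr (M1 \<Otimes>\<^sub>M M2) N H = M1 \<bind> (\<lambda>x. distr M2 N (\<lambda>y. H (x, y)))"
proof -
  have kernel: "(\<lambda>x. M2 \<bind> (\<lambda>y. return (M1 \<Otimes>\<^sub>M M2) (x, y))) \<in>
      measurable M1 (subprob_algebra (M1 \<Otimes>\<^sub>M M2))"
    using M2.subprob_space_axioms
    by (intro measurable_bind[where N = M2] measurable_const)
       (auto simp: space_subprob_algebra intro!: measurable_compose[OF _ return_measurable])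
  have "distr (M1 \<Otimes>\<^sub>M M2) N H =
      distr (M1 \<bind> (\<lambda>x. M2 \<bind> (\<lambda>y. return (M1 \<Otimes>\<^sub>M M2) (x, y)))) N H"
    using pair_measure_eq_bind by simp
  also have "\<dots> = M1 \<bind> (\<lambda>x. distr (M2 \<bind> (\<lambda>y. return (M1 \<Otimes>\<^sub>M M2) (x, y))) N H)"
    by (rule distr_bind[OF kernel M1.not_empty H])
  also have "\<dots> = M1 \<bind> (\<lambda>x. distr M2 N (\<lambda>y. H (x, y)))"
  proof (intro bind_cong refl)
    fix x assume x: "x \<in> space M1"
    have "M2 \<bind> (\<lambda>y. return (M1 \<Otimes>\<^sub>M M2) (x, y)) = distr M2 (M1 \<Otimes>\<^sub>M M2) (Pair x)"
      using x M2.not_empty by (intro bind_return_distr') auto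
    then show "distr (M2 \<bind> (\<lambda>y. return (M1 \<Otimes>\<^sub>M M2) (x, y))) N H = distr M2 N (\<lambda>y. H (x, y))"
      using H x by (simp add: distr_distr comp_def)
  qed
  finally show ?thesis .
qed

text \<open>
  The independence of two random variables, expressed by the sigma-algebras that they generate
  so that the variables may take values in different types.
\<close>

lemma (in prob_space) distr_Pair_eq_pair_measure:
  assumes X: "X \<in> measurable M S" and E: "E \<in> measurable M T"
    and indep: "indep_set (sets (vimage_algebra (space M) X S)) (sets (vimage_algebra (space M) E T))"
  shows "distr M S X \<Otimes>\<^sub>M distr M T E = distr M (S \<Otimes>\<^sub>M T) (\<lambda>\<omega>. (X \<omega>, E \<omega>))"
proof (rule pair_measure_eqI)
  interpret X: prob_space "distr M S X" by (rule prob_space_distr) fact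
  interpret E: prob_space "distr M T E" by (rule prob_space_distr) fact
  show "sigma_finite_measure (distr M S X)" "sigma_finite_measure (distr M T E)" ..
  fix A B assume A: "A \<in> sets (distr M S X)" and B: "B \<in> sets (distr M T E)"
  have "prob ((X -` A \<inter> space M) \<inter> (E -` B \<inter> space M)) =
      prob (X -` A \<inter> space M) * prob (E -` B \<inter> space M)"
    using A B by (intro indep_setD[OF indep]) (auto intro!: in_vimage_algebra)
  moreover have "(\<lambda>\<omega>. (X \<omega>, E \<omega>)) -` (A \<times> B) \<inter> space M =
      (X -` A \<inter> space M) \<inter> (E -` B \<inter> space M)"
    by auto
  ultimately show "emeasure (distr M S X) A * emeasure (distr M T E) B =
      emeasure (distr M (S \<Otimes>\<^sub>M T) (\<lambda>\<omega>. (X \<omega>, E \<omega>))) (A \<times> B)"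
    using A B X E by (simp add: emeasure_distr emeasure_eq_measure ennreal_mult)
qed simp

text \<open>
  Disintegration: if \<open>E\<close> is independent of \<open>X\<close>, the law of \<open>G x E\<close> for fixed \<open>x\<close> is a
  version of the conditional law of \<open>G X E\<close> given \<open>X = x\<close>.
\<close>

lemma (in prob_space) distr_graph_eq_bind:
  assumes X[measurable]: "X \<in> measurable M S" and E[measurable]: "E \<in> measurable M T"
    and indep: "indep_set (sets (vimage_algebra (space M) X S)) (sets (vimage_algebra (space M) E T))"
    and G: "case_prod G \<in> measurable (S \<Otimes>\<^sub>M T) R"
  shows "distr M (S \<Otimes>\<^sub>M R) (\<lambda>\<omega>. (X \<omega>, G (X \<omega>) (E \<omega>))) =
    distr M S X \<bind> (\<lambda>x. distr (distr M R (\<lambda>\<omega>. G x (E \<omega>))) (S \<Otimes>\<^sub>M R) (Pair x))"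
proof -
  have G2[measurable]: "(\<lambda>x. G (f x) (g x)) \<in> measurable L R"
    if "f \<in> measurable L S" "g \<in> measurable L T" for f g and L :: "'x measure"
    using measurable_compose[OF measurable_Pair[OF that] G] by simp
  let ?H = "\<lambda>(x, e). (x, G x e)"
  have H: "?H \<in> measurable (S \<Otimes>\<^sub>M T) (S \<Otimes>\<^sub>M R)"
    using G by (simp add: split_beta')
  interpret X: prob_space "distr M S X" by (rule prob_space_distr) fact
  interpret E: prob_space "distr M T E" by (rule prob_space_distr) fact
  interpret P: pair_prob_space "distr M S X" "distr M T E" ..
  have "distr M (S \<Otimes>\<^sub>M R) (\<lambda>\<omega>. (X \<omega>, G (X \<omega>) (E \<omega>))) =
      distr (distr M S X \<Otimes>\<^sub>M distr M T E) (S \<Otimes>\<^sub>M R) ?H"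
    unfolding distr_Pair_eq_pair_measure[OF X E indep]
    by (subst distr_distr) (use H in \<open>auto simp: comp_def\<close>)
  also have "\<dots> = distr M S X \<bind> (\<lambda>x. distr (distr M T E) (S \<Otimes>\<^sub>M R) (\<lambda>e. ?H (x, e)))"
    using H by (intro P.distr_pair_eq_bind) simp
  also have "\<dots> = distr M S X \<bind> (\<lambda>x. distr (distr M R (\<lambda>\<omega>. G x (E \<omega>))) (S \<Otimes>\<^sub>M R) (Pair x))"
  proof (intro bind_cong refl)
    fix x assume "x \<in> space (distr M S X)"
    then have x: "x \<in> space S" by simp
    then show "distr (distr M T E) (S \<Otimes>\<^sub>M R) (\<lambda>e. ?H (x, e)) =
        distr (distr M R (\<lambda>\<omega>. G x (E \<omega>))) (S \<Otimes>\<^sub>M R) (Pair x)"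
      by (simp add: distr_distr comp_def)
  qed
  finally show ?thesis .
qed

text \<open>
  A sigma-algebra on a single point carries only one probability measure; this settles the
  degenerate case of an empty sample.
\<close>

lemma prob_space_eq_PiM_empty:
  assumes "prob_space P" "sets P = sets (PiM {} N)"
  shows "P = PiM {} N"
proof (rule measure_eqI)
  interpret P: prob_space P by fact
  interpret E: prob_space "PiM {} N" by (rule prob_space_PiM) simp
  have spaces: "space P = space (PiM {} N)" by (rule sets_eq_imp_space_eq) fact
  fix A assume "A \<in> sets P"
  then have "A = {} \<or> A = space P"
    using assms(2) spaces by (auto simp: sets_PiM_empty space_PiM_empty)
  then show "emeasure P A = emeasure (PiM {} N) A"
    using P.emeasure_space_1 E.emeasure_space_1 spaces by auto
qed fact

lemma (in prob_space) distr_restrict_eq_PiM: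
  assumes "indep_vars N X I"
  shows "distr M (PiM I N) (\<lambda>\<omega>. \<lambda>i\<in>I. X i \<omega>) = PiM I (\<lambda>i. distr M (N i) (X i))"
proof (cases "I = {}")
  case True
  then show ?thesis
    by (auto intro!: prob_space_eq_PiM_empty prob_space_distr measurable_restrict simp: sets_PiM_empty)
next
  case False
  then show ?thesis
    using assms indep_vars_iff_distr_eq_PiM'[of I X N] by (auto simp: indep_vars_def)
qed

text \<open>
  When the kernels ignore the earlier outputs, each sequential step adjoins an independent
  coordinate, so the steps build up the product measure.
\<close>

lemma joint_output_noninteractive:
  assumes "\<And>i. i \<in> {1..m} \<Longrightarrow> prob_space (D i)" "\<And>i. i \<in> {1..m} \<Longrightarrow> sets (D i) = sets S"
    and "\<And>i z. i \<in> {1..m} \<Longrightarrow> K i (u i, z) = D i"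
  shows "joint_output S K u m = PiM {1..m} D"
  using assms
proof (induction m)
  case 0
  show ?case
    by (auto intro!: prob_space_eq_PiM_empty prob_space_return simp: sets_PiM_empty space_PiM_empty)
next
  case (Suc m)
  let ?R = "PiM {1..m} D" and ?k = "Suc m"
  have ins: "{1..?k} = insert ?k {1..m}" by auto
  interpret k: prob_space "D ?k" using Suc.prems by simp
  interpret R: prob_space ?R using Suc.prems by (intro prob_space_PiM) simp
  interpret P: pair_prob_space ?R "D ?k" ..
  interpret P': pair_sigma_finite "D ?k" ?R ..
  have swap: "(\<lambda>(x, y). (y, x)) \<in> measurable (?R \<Otimes>\<^sub>M D ?k) (D ?k \<Otimes>\<^sub>M ?R)"
    by measurable
  have upd: "(\<lambda>(x, f). f(?k := x)) \<in> measurable (D ?k \<Otimes>\<^sub>M ?R) (PiM {1..?k} D)"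
    unfolding ins by measurable
  have sets_PiM: "sets (PiM {1..?k} (\<lambda>_. S)) = sets (PiM {1..?k} D)"
    using Suc.prems by (intro sets_PiM_cong) auto
  have "joint_output S K u ?k = ?R \<bind> (\<lambda>z. distr (D ?k) (PiM {1..?k} (\<lambda>_. S)) (\<lambda>w. z(?k := w)))"
    using Suc by simp
  also have "\<dots> = ?R \<bind> (\<lambda>z. distr (D ?k) (PiM {1..?k} D) (\<lambda>w. z(?k := w)))"
    using sets_PiM by (intro bind_cong distr_cong refl)
  also have "\<dots> = distr (?R \<Otimes>\<^sub>M D ?k) (PiM {1..?k} D) (\<lambda>(f, x). f(?k := x))"
    unfolding ins by (subst P.distr_pair_eq_bind[OF measurable_add_dim]) simp
  also have "\<dots> = distr (D ?k \<Otimes>\<^sub>M ?R) (PiM {1..?k} D) (\<lambda>(x, f). f(?k := x))"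
    by (subst P'.distr_pair_swap, subst distr_distr[OF upd swap])
       (simp add: comp_def split_beta')
  also have "\<dots> = PiM {1..?k} D"
    using Suc.prems by (simp only: ins) (intro distr_pair_PiM_eq_PiM, auto)
  finally show ?case .
qed

section \<open>The law of one privatised array\<close>

lemma measurable_bin_array [measurable]: "(\<lambda>x. bin_array h x j) \<in> borel_measurable borel"
proof -
  have [measurable]: "(\<lambda>x. infnorm (x - grid_point h j)) \<in> borel_measurable borel"
    by (intro borel_measurable_continuous_onI continuous_intros)
  show ?thesis unfolding bin_array_def by measurable
qed

lemma measurable_privatise:
  "(\<lambda>(u, e). privatise n h i u e) \<in> measurable (observation_space \<Otimes>\<^sub>M array_space) array_space"
proof (rule measurable_PiM_single')
  fix j :: "int ^ 'd"
  have [measurable]: "(\<lambda>y. y) \<in> borel_measurable (count_space {0, 1 :: real})"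
    by simp
  have "(\<lambda>p. (if i \<le> n then bin_array h (fst (fst p)) j
      else snd (fst p) * bin_array h (fst (fst p)) j) + snd p j)
    \<in> borel_measurable (observation_space \<Otimes>\<^sub>M array_space)"
    by (cases "i \<le> n") (simp_all, measurable)
  then show "(\<lambda>p. (case p of (u, e) \<Rightarrow> privatise n h i u e) j)
    \<in> borel_measurable (observation_space \<Otimes>\<^sub>M array_space)"
    by (simp add: privatise_def split_beta')
qed simp

lemma (in prob_space) measurable_distr_parametric:
  assumes "E \<in> measurable M T" "case_prod G \<in> measurable (S \<Otimes>\<^sub>M T) R"
  shows "(\<lambda>x. distr M R (\<lambda>\<omega>. G x (E \<omega>))) \<in> measurable S (prob_algebra R)"
proof (rule measurable_distr_prob_space2[where M = M])
  show "(\<lambda>_. M) \<in> measurable S (prob_algebra M)"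
    using prob_space_axioms by (intro measurable_const) (simp add: space_prob_algebra)
  have "(\<lambda>p. (fst p, E (snd p))) \<in> measurable (S \<Otimes>\<^sub>M M) (S \<Otimes>\<^sub>M T)"
    using assms(1) by measurable
  from measurable_compose[OF this assms(2)]
  show "(\<lambda>(x, \<omega>). G x (E \<omega>)) \<in> measurable (S \<Otimes>\<^sub>M M) R"
    by (simp add: split_beta')
qed

text \<open>
  Adding the input array to the independent noise entries gives a product of shifted Laplace
  laws.  For two inputs the shifts agree outside the union of the supports of the two bin arrays,
  and the rate is chosen so that the at most \<open>2 ^ (d + 1)\<close> factors multiply up to \<open>exp \<alpha>\<close>.
\<close>

lemma (in prob_space) privatise_emeasure_le:
  fixes e :: "'a \<Rightarrow> int ^ 'd \<Rightarrow> real"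
  assumes \<alpha>: "\<alpha> > 0" and h: "h > 0"
    and laplace: "\<And>j. distributed M lborel (\<lambda>\<omega>. e \<omega> j) (laplace_density (\<alpha> / 2 ^ (CARD('d) + 1)))"
    and indep: "indep_vars (\<lambda>_. borel) (\<lambda>j \<omega>. e \<omega> j) UNIV"
    and u: "u \<in> space observation_space" "u' \<in> space observation_space"
    and A: "A \<in> sets array_space"
  shows "emeasure (distr M array_space (\<lambda>\<omega>. privatise n h i u (e \<omega>))) A \<le>
    exp \<alpha> * emeasure (distr M array_space (\<lambda>\<omega>. privatise n h i u' (e \<omega>))) A"
proof -
  define s where "s u j = (if i \<le> n then bin_array h (fst u) j else snd u * bin_array h (fst u) j)"
    for u :: "(real ^ 'd) \<times> real" and j
  define D where "D u j = distr M borel (\<lambda>\<omega>. s u j + e \<omega> j)" for u j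
  have privatise: "privatise n h i u (e \<omega>) = (\<lambda>j. s u j + e \<omega> j)" for u \<omega>
    by (auto simp: privatise_def s_def split_beta')
  have e [measurable]: "(\<lambda>\<omega>. e \<omega> j) \<in> borel_measurable M" for j
    using indep by (simp add: indep_vars_def)
  have law: "distr M array_space (\<lambda>\<omega>. privatise n h i u (e \<omega>)) = PiM UNIV (D u)" for u
  proof -
    have "indep_vars (\<lambda>_. borel) (\<lambda>j \<omega>. s u j + e \<omega> j) UNIV"
      by (rule indep_vars_compose2[OF indep]) simp
    from distr_restrict_eq_PiM[OF this] show ?thesis
      by (simp add: privatise D_def[abs_def] restrict_UNIV)
  qed
  let ?b = "\<alpha> / 2 ^ (CARD('d) + 1)"
  let ?N = "\<lambda>u. {j. bin_array h (fst u) j \<noteq> 0}"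
  \<comment> \<open>A zero label only removes entries, so the supports of the bin arrays serve both kinds of output.\<close>
  define F where "F = ?N u \<union> ?N u'"
  have fin: "finite F"
    using bin_array_support(1)[OF h, of "fst u"] bin_array_support(1)[OF h, of "fst u'"]
    by (simp add: F_def)
  have "card F \<le> card (?N u) + card (?N u')"
    unfolding F_def by (rule card_Un_le)
  also have "\<dots> \<le> 2 ^ (CARD('d) + 1)"
    using bin_array_support(2)[OF h, of "fst u"] bin_array_support(2)[OF h, of "fst u'"] by simp
  finally have card: "real (card F) \<le> 2 ^ (CARD('d) + 1)"
    by (metis of_nat_le_iff of_nat_numeral of_nat_power)
  have s01: "0 \<le> s u j \<and> s u j \<le> 1" if "u \<in> space observation_space" for u j
    using that by (auto simp: s_def bin_array_def space_pair_measure)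
  have diff: "\<bar>s u j - s u' j\<bar> \<le> 1" for j
    using s01[OF u(1), of j] s01[OF u(2), of j] by linarith
  have coord: "emeasure (D u j) B \<le> exp ?b * emeasure (D u' j) B" if "B \<in> sets (D u j)" for j B
  proof -
    have "emeasure (D u j) B \<le> exp (?b * \<bar>s u j - s u' j\<bar>) * emeasure (D u' j) B"
      unfolding D_def using that \<alpha>
      by (intro emeasure_shift_laplace_le laplace) (auto simp: D_def)
    also have "\<dots> \<le> exp ?b * emeasure (D u' j) B"
      using \<alpha> diff[of j] mult_left_mono[of "\<bar>s u j - s u' j\<bar>" 1 ?b]
      by (intro mult_right_mono ennreal_leI) auto
    finally show ?thesis .
  qed
  have "emeasure (PiM UNIV (D u)) A \<le> ennreal (exp ?b) ^ card F * emeasure (PiM UNIV (D u')) A"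
  proof (rule emeasure_PiM_le_power_card[OF fin])
    show "D u j = D u' j" if "j \<in> UNIV - F" for j
      using that by (simp add: D_def s_def F_def)
    show "A \<in> sets (PiM UNIV (D u))"
      using A by (simp add: D_def cong: sets_PiM_cong)
  qed (use coord in \<open>auto simp: D_def intro!: prob_space_distr\<close>)
  also have "ennreal (exp ?b) ^ card F = ennreal (exp (card F * ?b))"
    by (simp only: ennreal_power exp_ge_zero exp_of_nat_mult)
  also have "\<dots> \<le> ennreal (exp \<alpha>)"
    using card \<alpha> by (intro ennreal_leI) (simp add: field_simps)
  finally show ?thesis
    by (simp add: law mult_right_mono)
qed

section \<open>Local differential privacy of the mechanism\<close>

theorem theorem2p1:
  fixes M :: "'w measure"
    and n :: nat
    and \<alpha> h :: real
    and X :: "nat \<Rightarrow> 'w \<Rightarrow> real ^ 'd"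
    and Y :: "nat \<Rightarrow> 'w \<Rightarrow> real"
    and \<epsilon> :: "nat \<Rightarrow> 'w \<Rightarrow> int ^ 'd \<Rightarrow> real"
    and Z :: "nat \<Rightarrow> 'w \<Rightarrow> int ^ 'd \<Rightarrow> real"
    and Q :: "(nat \<Rightarrow> (real ^ 'd) \<times> real) \<Rightarrow> (nat \<Rightarrow> int ^ 'd \<Rightarrow> real) measure"
  assumes "\<alpha> > 0" and "h > 0"
    and "prob_space M"
    and "\<And>i. i \<in> {1..2*n} \<Longrightarrow> X i \<in> borel_measurable M"
    and "\<And>i. i \<in> {1..2*n} \<Longrightarrow> Y i \<in> measurable M (count_space {0, 1})"
    and eps_laplace: "\<And>i j. i \<in> {1..2*n} \<Longrightarrow>
          distributed M lborel (\<lambda>\<omega>. \<epsilon> i \<omega> j) (laplace_density (\<alpha> / 2 ^ (CARD('d) + 1)))"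
    and eps_entries_indep: "\<And>i. i \<in> {1..2*n} \<Longrightarrow>
          prob_space.indep_vars M (\<lambda>_. borel) (\<lambda>j \<omega>. \<epsilon> i \<omega> j) UNIV"
    and eps_arrays_indep: "prob_space.indep_vars M (\<lambda>_. array_space) \<epsilon> {1..2*n}"
    and eps_data_indep: "prob_space.indep_set M
          (sets (vimage_algebra (space M) (\<lambda>\<omega>. \<lambda>i\<in>{1..2*n}. (X i \<omega>, Y i \<omega>))
            (PiM {1..2*n} (\<lambda>_. observation_space))))
          (sets (vimage_algebra (space M) (\<lambda>\<omega>. \<lambda>i\<in>{1..2*n}. \<epsilon> i \<omega>)
            (PiM {1..2*n} (\<lambda>_. array_space))))"
    and Z_first: "\<And>i \<omega>. i \<in> {1..n} \<Longrightarrow>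
          Z i \<omega> = (\<lambda>j. bin_array h (X i \<omega>) j + \<epsilon> i \<omega> j)"
    and Z_second: "\<And>i \<omega>. i \<in> {n+1..2*n} \<Longrightarrow>
          Z i \<omega> = (\<lambda>j. Y i \<omega> * bin_array h (X i \<omega>) j + \<epsilon> i \<omega> j)"
    and Q_def: "\<And>u. Q u = distr M (PiM {1..2*n} (\<lambda>_. array_space))
          (\<lambda>\<omega>. \<lambda>i\<in>{1..2*n}. privatise n h i (u i) (\<epsilon> i \<omega>))"
  shows "Q \<in> ldp_mechanisms (2*n) observation_space array_space \<alpha> \<and>
         distr M (PiM {1..2*n} (\<lambda>_. observation_space) \<Otimes>\<^sub>M PiM {1..2*n} (\<lambda>_. array_space))
           (\<lambda>\<omega>. (\<lambda>i\<in>{1..2*n}. (X i \<omega>, Y i \<omega>), \<lambda>i\<in>{1..2*n}. Z i \<omega>)) =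
         distr M (PiM {1..2*n} (\<lambda>_. observation_space)) (\<lambda>\<omega>. \<lambda>i\<in>{1..2*n}. (X i \<omega>, Y i \<omega>)) \<bind>
           (\<lambda>u. distr (Q u)
             (PiM {1..2*n} (\<lambda>_. observation_space) \<Otimes>\<^sub>M PiM {1..2*n} (\<lambda>_. array_space)) (Pair u))"
proof
  interpret prob_space M by fact
  let ?I = "{1..2*n}"
  let ?U = "PiM ?I (\<lambda>_. observation_space :: ((real ^ 'd) \<times> real) measure)"
  let ?S = "PiM ?I (\<lambda>_. array_space :: (int ^ 'd \<Rightarrow> real) measure)"
  define D where "D i u = distr M array_space (\<lambda>\<omega>. privatise n h i u (\<epsilon> i \<omega>))" for i u
  define K where "K i = (\<lambda>(u, z :: nat \<Rightarrow> int ^ 'd \<Rightarrow> real). D i u)" for i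
  define G where "G u e = (\<lambda>i\<in>?I. privatise n h i (u i) (e i))"
    for u :: "nat \<Rightarrow> (real ^ 'd) \<times> real" and e
  let ?data = "\<lambda>\<omega>. \<lambda>i\<in>?I. (X i \<omega>, Y i \<omega>)" and ?noise = "\<lambda>\<omega>. \<lambda>i\<in>?I. \<epsilon> i \<omega>"

  have \<epsilon> [measurable]: "\<epsilon> i \<in> measurable M array_space" if "i \<in> ?I" for i
    using eps_arrays_indep that by (simp add: indep_vars_def)
  have privatise [measurable]: "(\<lambda>x. privatise n h i (f x) (g x)) \<in> measurable L array_space"
    if "f \<in> measurable L observation_space" "g \<in> measurable L array_space"
    for i and f :: "_ \<Rightarrow> (real ^ 'd) \<times> real" and g and L :: "'x measure"
    using measurable_compose[OF measurable_Pair[OF that] measurable_privatise] by simp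
  have data: "?data \<in> measurable M ?U"
    using assms(4,5) by (intro measurable_restrict measurable_Pair) auto
  have noise: "?noise \<in> measurable M ?S"
    using \<epsilon> by (intro measurable_restrict) auto
  have G: "case_prod G \<in> measurable (?U \<Otimes>\<^sub>M ?S) ?S"
    unfolding G_def split_beta' by (intro measurable_restrict privatise) measurable
  \<comment> \<open>\<open>Q u\<close> depends on the noise only through its restriction to the sample, which is the variable
    that is independent of the data.\<close>
  have Q_eq: "Q u = distr M ?S (\<lambda>\<omega>. G u (?noise \<omega>))" for u
    unfolding Q_def G_def by (intro arg_cong[where f = "distr M ?S"] ext) auto
  have D: "D i \<in> measurable observation_space (prob_algebra array_space)" if "i \<in> ?I" for i
    unfolding D_def[abs_def]
    by (rule measurable_distr_parametric[OF \<epsilon>[OF that] measurable_privatise])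

  have Q_product: "Q u = PiM ?I (\<lambda>i. D i (u i))" if "u \<in> space ?U" for u
  proof -
    have "indep_vars (\<lambda>_. array_space) (\<lambda>i \<omega>. privatise n h i (u i) (\<epsilon> i \<omega>)) ?I"
      using that by (intro indep_vars_compose2[OF eps_arrays_indep] privatise measurable_const)
        (auto simp: space_PiM)
    from distr_restrict_eq_PiM[OF this] show ?thesis
      by (simp add: Q_def D_def)
  qed

  have "Q \<in> measurable ?U (prob_algebra ?S)"
    unfolding Q_eq[abs_def] by (rule measurable_distr_parametric[OF noise G])
  moreover have "specified_by (2*n) observation_space array_space Q K"
    unfolding specified_by_def conditional_kernels_def
  proof (intro conjI ballI)
    show "K i \<in> measurable (observation_space \<Otimes>\<^sub>M PiM {1..<i} (\<lambda>_. array_space))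
        (prob_algebra array_space)"
      if "i \<in> ?I" for i
      using measurable_compose[OF measurable_fst D[OF that]] by (simp add: K_def split_beta')
    show "Q u = joint_output array_space K u (2*n)" if u: "u \<in> space ?U" for u
    proof -
      have D_prob: "D i (u i) \<in> space (prob_algebra array_space)" if "i \<in> ?I" for i
        using u that by (intro measurable_space[OF D]) (auto simp: space_PiM)
      show ?thesis
        unfolding Q_product[OF u] using D_prob
        by (intro joint_output_noninteractive[symmetric]) (auto simp: space_prob_algebra K_def)
    qed
  qed
  moreover have "ldp_kernels (2*n) observation_space array_space \<alpha> K"
    unfolding ldp_kernels_def
  proof (intro ballI)
    fix i A z u u'
    assume i: "i \<in> ?I" and A: "A \<in> sets (array_space :: (int ^ 'd \<Rightarrow> real) measure)"
      and u: "u \<in> space (observation_space :: ((real ^ 'd) \<times> real) measure)"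
        "u' \<in> space (observation_space :: ((real ^ 'd) \<times> real) measure)"
    have fin: "finite_measure (D i v)" if "v \<in> space observation_space" for v
      using measurable_space[OF D[OF i] that]
      by (auto simp: space_prob_algebra intro: prob_space.finite_measure)
    have "emeasure (D i u) A \<le> exp \<alpha> * emeasure (D i u') A"
      unfolding D_def
      using privatise_emeasure_le[OF \<open>\<alpha> > 0\<close> \<open>h > 0\<close> eps_laplace[OF i] eps_entries_indep[OF i] u A] .
    then show "measure (K i (u, z)) A \<le> exp \<alpha> * measure (K i (u', z)) A"
      using fin u
      by (simp add: K_def finite_measure.emeasure_eq_measure ennreal_mult'[symmetric])
  qed
  ultimately show "Q \<in> ldp_mechanisms (2*n) observation_space array_space \<alpha>"
    by (auto simp: ldp_mechanisms_def)

  have Z: "(\<lambda>i\<in>?I. Z i \<omega>) = G (?data \<omega>) (?noise \<omega>)" for \<omega>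
    unfolding G_def
  proof (intro restrict_ext)
    fix i assume i: "i \<in> ?I"
    show "Z i \<omega> = privatise n h i (?data \<omega> i) (?noise \<omega> i)"
      using i Z_first[of i \<omega>] Z_second[of i \<omega>]
      by (cases "i \<le> n") (auto simp: privatise_def)
  qed
  show "distr M (?U \<Otimes>\<^sub>M ?S) (\<lambda>\<omega>. (?data \<omega>, \<lambda>i\<in>?I. Z i \<omega>)) =
      distr M ?U ?data \<bind> (\<lambda>u. distr (Q u) (?U \<Otimes>\<^sub>M ?S) (Pair u))"
    unfolding Z Q_eq by (rule distr_graph_eq_bind[OF data noise eps_data_indep G])
qed

end
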